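(* Let $A$ be a pseudo $BL$-algebra and $F$ an interval valued fuzzy set of $A$. Then for every interval number $\widehat t$ with $[0.5,0.5]<\widehat t\le[1,1]$ the level subset $F_{\widehat t}=\{x\in A\mid\widehat{\mu_F}(x)\ge\widehat t\}$, whenever nonempty, is an implicative filter of $A$, if and only if for all $x,y\in A$ the following hold: (F9) $\mathrm{rmax}\{\widehat{\mu_F}(x\odot y),[0.5,0.5]\}\ge\mathrm{rmin}\{\widehat{\mu_F}(x),\widehat{\mu_F}(y)\}$; (F10) $\mathrm{rmax}\{\widehat{\mu_F}(y),[0.5,0.5]\}\ge\widehat{\mu_F}(x)$ whenever $x\le y$; (F14) $\mathrm{rmax}\{\widehat{\mu_F}(x),[0.5,0.5]\}\ge\widehat{\mu_F}((x\rightarrow y)\hookrightarrow x)$ and $\mathrm{rmax}\{\widehat{\mu_F}(x),[0.5,0.5]\}\ge\widehat{\mu_F}((x\hookrightarrow y)\rightarrow x)$.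
   Context: A pseudo $BL$-algebra is an algebra $(A;\wedge,\vee,\odot,\rightarrow,\hookrightarrow,0,1)$ of type $(2,2,2,2,2,0,0)$ such that $(A,\wedge,\vee,0,1)$ is a bounded lattice with lattice order $\le$, $(A,\odot,1)$ is a monoid, and for all $x,y,z\in A$: (a1) $x\odot y\le z\iff x\le y\rightarrow z\iff y\le x\hookrightarrow z$; (a2) $x\wedge y=(x\rightarrow y)\odot x=x\odot(x\hookrightarrow y)$; (a3) $(x\rightarrow y)\vee(y\rightarrow x)=(x\hookrightarrow y)\vee(y\hookrightarrow x)=1$. A filter of $A$ is a nonempty $I\subseteq A$ with $x\odot y\in I$ for $x,y\in I$, and $x\in I$, $x\le y$ imply $y\in I$. A filter $I$ is implicative if for all $x,y\in A$, $(x\rightarrow y)\hookrightarrow x\in I$ implies $x\in I$, and $(x\hookrightarrow y)\rightarrow x\in I$ implies $x\in I$. An interval number is $\widehat{a}=[a^{\bot},a^{\top}]$ with $0\le a^{\bot}\le a^{\top}\le 1$; $D[0,1]$ is the set of interval numbers. $\widehat{a}\le\widehat{b}$ iff $a^{\bot}\le b^{\bot}$ and $a^{\top}\le b^{\top}$; $\widehat{a}<\widehat{b}$ iff $\widehat{a}\le\widehat{b}$ and $\widehat{a}\ne\widehat{b}$; $\mathrm{rmin},\mathrm{rmax}$ are componentwise. An interval valued fuzzy set $F$ of $A$ is a map $\widehat{\mu_F}:A\to D[0,1]$; standing assumption: for every $x\in A$, either $\widehat{\mu_F}(x)<[0.5,0.5]$ or $[0.5,0.5]\le\widehat{\mu_F}(x)$.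 *)

theory Defs
  imports Complex_Main "HOL-Library.Product_Order"
begin

text \<open>
  The bounded lattice and the monoid are those of the library classes, so the monoid operation
  is written \<open>*\<close>, and the constants 0 and 1 of the signature are \<open>bot\<close> and \<open>1\<close>;
  \<open>one_eq_top\<close> says that the unit of the monoid is the greatest element of the lattice.
\<close>

class pseudo_BL_algebra = bounded_lattice + monoid_mult +
  fixes imp_l :: "'a \<Rightarrow> 'a \<Rightarrow> 'a"  (infixr \<open>\<^bold>\<rightarrow>\<close> 60)
    and imp_r :: "'a \<Rightarrow> 'a \<Rightarrow> 'a"  (infixr \<open>\<^bold>\<hookrightarrow>\<close> 60)
  assumes one_eq_top: "1 = top"
    and residual_l: "x * y \<le> z \<longleftrightarrow> x \<le> (y \<^bold>\<rightarrow> z)"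
    and residual_r: "x * y \<le> z \<longleftrightarrow> y \<le> (x \<^bold>\<hookrightarrow> z)"
    and divisible_l: "inf x y = (x \<^bold>\<rightarrow> y) * x"
    and divisible_r: "inf x y = x * (x \<^bold>\<hookrightarrow> y)"
    and prelinear_l: "sup (x \<^bold>\<rightarrow> y) (y \<^bold>\<rightarrow> x) = 1"
    and prelinear_r: "sup (x \<^bold>\<hookrightarrow> y) (y \<^bold>\<hookrightarrow> x) = 1"

definition pBL_filter :: "'a::pseudo_BL_algebra set \<Rightarrow> bool" where
  "pBL_filter I \<longleftrightarrow> I \<noteq> {} \<and> (\<forall>x\<in>I. \<forall>y\<in>I. x * y \<in> I) \<and> (\<forall>x y. x \<in> I \<longrightarrow> x \<le> y \<longrightarrow> y \<in> I)"

definition implicative_filter :: "'a::pseudo_BL_algebra set \<Rightarrow> bool" where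
  "implicative_filter I \<longleftrightarrow> pBL_filter I \<and>
     (\<forall>x y. ((x \<^bold>\<rightarrow> y) \<^bold>\<hookrightarrow> x \<in> I \<longrightarrow> x \<in> I) \<and> ((x \<^bold>\<hookrightarrow> y) \<^bold>\<rightarrow> x \<in> I \<longrightarrow> x \<in> I))"

text \<open>
  An interval number is represented by the pair of its end points. The relations
  \<open>\<le>\<close> and \<open><\<close> on interval numbers are the componentwise order on pairs from
  \<^theory>\<open>HOL-Library.Product_Order\<close> and its strict part (\<open>\<le>\<close> and \<open>\<noteq>\<close>). The type
  of intervals in the library is not used because its order is inclusion.
\<close>

type_synonym interval_number = "real \<times> real"

definition D01 :: "interval_number set" where
  "D01 = {(a, b). 0 \<le> a \<and> a \<le> b \<and> b \<le> 1}"

definition rmin :: "interval_number \<Rightarrow> interval_number \<Rightarrow> interval_number" where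
  "rmin a b = (min (fst a) (fst b), min (snd a) (snd b))"

definition rmax :: "interval_number \<Rightarrow> interval_number \<Rightarrow> interval_number" where
  "rmax a b = (max (fst a) (fst b), max (snd a) (snd b))"

abbreviation half :: interval_number where
  "half \<equiv> (1/2, 1/2)"

text \<open>The second conjunct is the standing assumption that every value is comparable with
  \<open>[0.5, 0.5]\<close>.\<close>

definition iv_fuzzy_set :: "('a \<Rightarrow> interval_number) \<Rightarrow> bool" where
  "iv_fuzzy_set F \<longleftrightarrow> (\<forall>x. F x \<in> D01) \<and> (\<forall>x. F x < half \<or> half \<le> F x)"

definition level_subset :: "('a \<Rightarrow> interval_number) \<Rightarrow> interval_number \<Rightarrow> 'a set" where
  "level_subset F t = {x. F x \<ge> t}"

end

theory Submission imports Defs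
begin

text \<open>
  Comparability with \<open>[0.5, 0.5]\<close> makes \<open>u \<le> rmax a half\<close> equivalent to
  \<open>half < u \<longrightarrow> u \<le> a\<close>. Hence each of the conditions (F9), (F10), (F14) says that the matching
  closure property holds in the level subset of its right-hand side, and
  in every smaller level above \<open>[0.5, 0.5]\<close> by transitivity.
\<close>

lemma le_rmin_iff: "t \<le> rmin a b \<longleftrightarrow> t \<le> a \<and> t \<le> b"
  by (auto simp: rmin_def less_eq_prod_def)

lemma rmin_in_D01: "a \<in> D01 \<Longrightarrow> b \<in> D01 \<Longrightarrow> rmin a b \<in> D01"
  by (auto simp: D01_def rmin_def split: prod.splits)

lemma D01_le_one: "a \<in> D01 \<Longrightarrow> a \<le> (1, 1)"
  by (auto simp: D01_def less_eq_prod_def)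

text \<open>If both intervals are at least \<open>h\<close>, so is their \<open>rmin\<close>;
  otherwise \<open>rmin\<close> lies below one that is strictly less than \<open>h\<close>. This
  lets \<open>le_rmax_iff\<close> apply to the left-hand side of (F9).\<close>

lemma rmin_comparable:
  assumes "a < h \<or> h \<le> a" "b < h \<or> h \<le> b"
  shows "rmin a b < h \<or> h \<le> rmin a b"
  using assms by (metis le_rmin_iff order.refl order.strict_trans1)

text \<open>By comparability \<open>rmax a h\<close> is one of \<open>a\<close> and
  \<open>h\<close>, not a mixture of their end points. If it is \<open>a\<close>, every
  \<open>u\<close> not above \<open>h\<close> is below \<open>a\<close> anyway; if it is
  \<open>h\<close>, then \<open>a < h\<close> and both sides say that \<open>u\<close> is not
  strictly above \<open>h\<close>.\<close>

lemma le_rmax_iff: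
  assumes "a < h \<or> h \<le> a" "u < h \<or> h \<le> u"
  shows "u \<le> rmax a h \<longleftrightarrow> (h < u \<longrightarrow> u \<le> a)"
proof -
  have "rmax a h = (if h \<le> a then a else h)"
    using assms(1) by (auto simp: rmax_def less_eq_prod_def less_prod_def prod_eq_iff)
  then show ?thesis
    using assms by (auto dest: order.strict_trans1 simp: order.order_iff_strict)
qed

theorem theorem4p4:
  fixes F :: "'a::pseudo_BL_algebra \<Rightarrow> interval_number"
  assumes "iv_fuzzy_set F"
  shows "(\<forall>t\<in>D01. half < t \<and> t \<le> (1, 1) \<longrightarrow> level_subset F t \<noteq> {} \<longrightarrow>
            implicative_filter (level_subset F t))
     \<longleftrightarrow>
     (\<forall>x y.
        rmax (F (x * y)) half \<ge> rmin (F x) (F y) \<and>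
        (x \<le> y \<longrightarrow> rmax (F y) half \<ge> F x) \<and>
        rmax (F x) half \<ge> F ((x \<^bold>\<rightarrow> y) \<^bold>\<hookrightarrow> x) \<and>
        rmax (F x) half \<ge> F ((x \<^bold>\<hookrightarrow> y) \<^bold>\<rightarrow> x))"
    (is "?levels \<longleftrightarrow> ?ineqs")
proof -
  have D: "F x \<in> D01" and cmp: "F x < half \<or> half \<le> F x" for x
    using assms by (auto simp: iv_fuzzy_set_def)
  note le_rmax = le_rmax_iff[OF cmp cmp] le_rmax_iff[OF cmp rmin_comparable[OF cmp cmp]]
  show ?thesis
  proof
    assume ?levels
    \<comment> \<open>The point \<open>z\<close> witnesses that the level subset is
      nonempty.\<close>
    then have filter: "implicative_filter (level_subset F t)"
      if "t \<in> D01" "half < t" "t \<le> F z" for t z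
      using that D01_le_one unfolding level_subset_def by blast
    show ?ineqs
      unfolding le_rmax
    proof (intro allI conjI impI)
      fix x y
      assume "half < rmin (F x) (F y)"
      moreover have "rmin (F x) (F y) \<le> F x" "rmin (F x) (F y) \<le> F y"
        using le_rmin_iff by blast+
      \<comment> \<open>The level \<open>rmin (F x) (F y)\<close> is the largest one whose subset
        contains both \<open>x\<close> and \<open>y\<close>.\<close>
      ultimately show "rmin (F x) (F y) \<le> F (x * y)"
        using filter rmin_in_D01[OF D D]
        unfolding implicative_filter_def pBL_filter_def level_subset_def by blast
    next
      fix x y :: 'a
      assume "x \<le> y" "half < F x"
      \<comment> \<open>Here, and for (F14) below, the level is the value of \<open>F\<close> at the
        element known to lie in the filter.\<close>
      then show "F x \<le> F y"
        using filter[OF D _ order.refl, of x]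
        unfolding implicative_filter_def pBL_filter_def level_subset_def by blast
    next
      fix x y
      assume "half < F ((x \<^bold>\<rightarrow> y) \<^bold>\<hookrightarrow> x)"
      then show "F ((x \<^bold>\<rightarrow> y) \<^bold>\<hookrightarrow> x) \<le> F x"
        using filter[OF D _ order.refl, of "(x \<^bold>\<rightarrow> y) \<^bold>\<hookrightarrow> x"]
        unfolding implicative_filter_def level_subset_def by blast
    next
      fix x y
      assume "half < F ((x \<^bold>\<hookrightarrow> y) \<^bold>\<rightarrow> x)"
      then show "F ((x \<^bold>\<hookrightarrow> y) \<^bold>\<rightarrow> x) \<le> F x"
        using filter[OF D _ order.refl, of "(x \<^bold>\<hookrightarrow> y) \<^bold>\<rightarrow> x"]
        unfolding implicative_filter_def level_subset_def by blast
    qed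
  next
    assume ineqs: ?ineqs
    show ?levels
    proof (intro ballI impI)
      fix t
      assume "half < t \<and> t \<le> (1, 1)" and nonempty: "level_subset F t \<noteq> {}"
      \<comment> \<open>From \<open>half < t\<close> and \<open>t \<le> u\<close> follows
        \<open>half < u\<close>, so the guard left by \<open>le_rmax\<close> is always met.\<close>
      then have up: "t \<le> F z" if "t \<le> u" "half < u \<longrightarrow> u \<le> F z" for u z
        using that order.strict_trans2 order.trans by blast
      have "t \<le> F (x * y)" if "t \<le> F x" "t \<le> F y" for x y
        using ineqs that unfolding le_rmax by (intro up[of "rmin (F x) (F y)"]) (auto simp: le_rmin_iff)
      moreover have "t \<le> F y" if "t \<le> F x" "x \<le> y" for x y
        using ineqs that up unfolding le_rmax by blast
      moreover have "t \<le> F x" if "t \<le> F ((x \<^bold>\<rightarrow> y) \<^bold>\<hookrightarrow> x)" for x y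
        using ineqs that up unfolding le_rmax by blast
      moreover have "t \<le> F x" if "t \<le> F ((x \<^bold>\<hookrightarrow> y) \<^bold>\<rightarrow> x)" for x y
        using ineqs that up unfolding le_rmax by blast
      ultimately show "implicative_filter (level_subset F t)"
        using nonempty unfolding implicative_filter_def pBL_filter_def level_subset_def by blast
    qed
  qed
qed

end
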